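(* Let $\theta\in[0,1)$ and $\omega=\mathcal{A}(\theta)$. (1) $\omega$ is a pure quadratic irrational number if and only if $\theta=m/(2^n-1)$ for some integers $n$, $m$ with $1\le m\le 2^n-2$. (2) Suppose $\theta=p/q$ with $p,q$ positive coprime integers and $\theta$ not of the form $m/2^n$. Then (i) $\omega$ is a pure quadratic irrational number if and only if $q$ is odd; (ii) $\omega$ is a non-pure quadratic irrational number if and only if $q$ is even. (3) The simple continued fraction expansion of $\omega$ is purely periodic if and only if $\theta=m/(2^n-1)$ with $m$ an even integer satisfying $2^{n-1}\le m\le 2^n-2$.
   Context: Stern's diatomic integers: $[2^0:0]=0$, $[2^0:1]=1$, $[2^{n+1}:2m]=[2^n:m]$, $[2^{n+1}:2m+1]=[2^n:m]+[2^n:m+1]$. Assembly function: the map $m/2^n\mapsto[2^n:m]/[2^n:2^n-m]$ ($0\le m\le 2^n-1$) extends uniquely to a continuous strictly increasing bijection $\mathcal{A}:[0,1)\to[0,\infty)$. An infinite design is an infinite binary sequence $d_1d_2\cdots$ that is not eventually constant, with design decimal $\theta_D=\sum_i d_i2^{-i}$. It is purely periodic if $D=PPP\cdots$ for some nonempty finite binary word $P$. A number $\omega=\mathcal{A}(\theta)$ is called a pure quadratic irrational number if $\theta=\theta_D$ for some purely periodic infinite design $D$; it is called a non-pure quadratic irrational number if it is a quadratic irrational (irrational root of an integer quadratic polynomial) but not pure. *)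

theory Defs
  imports "HOL-Analysis.Analysis"
begin

text \<open>
  \<open>stern n m\<close> is the diatomic integer \<open>[2^n : m]\<close>. It is meaningful for \<open>m \<le> 2^n\<close> only;
  the recursion never leaves this range.
\<close>
fun stern :: "nat \<Rightarrow> nat \<Rightarrow> nat" where
  "stern 0 m = (if m = 1 then 1 else 0)"
| "stern (Suc n) m =
     (if even m then stern n (m div 2) else stern n (m div 2) + stern n (m div 2 + 1))"

lemma stern_recursion:
  "stern 0 0 = 0"
  "stern 0 1 = 1"
  "stern (Suc n) (2 * m) = stern n m"
  "stern (Suc n) (2 * m + 1) = stern n m + stern n (m + 1)"
  by simp_all

text \<open>
  The value \<open>0\<close> outside \<open>[0,1)\<close> is only there to make the extension unique as a total function.
\<close>
definition assembly :: "real \<Rightarrow> real" where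
  "assembly = (THE f.
     (\<forall>n m. m < 2 ^ n \<longrightarrow>
        f (real m / 2 ^ n) = real (stern n m) / real (stern n (2 ^ n - m))) \<and>
     continuous_on {0..<1} f \<and>
     strict_mono_on {0..<1} f \<and>
     bij_betw f {0..<1} {0..} \<and>
     (\<forall>x. x \<notin> {0..<1} \<longrightarrow> f x = 0))"

text \<open>
  Binary sequences \<open>d\<^sub>1 d\<^sub>2 \<dots>\<close> are indexed from \<open>0\<close>: the digit \<open>d\<^sub>i\<close> is \<open>d (i - 1)\<close>.
\<close>
definition infinite_design :: "(nat \<Rightarrow> bool) \<Rightarrow> bool" where
  "infinite_design d \<longleftrightarrow> \<not> (\<exists>b N. \<forall>i\<ge>N. d i = b)"

definition design_decimal :: "(nat \<Rightarrow> bool) \<Rightarrow> real" where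
  "design_decimal d = (\<Sum>i. of_bool (d i) / 2 ^ Suc i)"

definition purely_periodic_design :: "(nat \<Rightarrow> bool) \<Rightarrow> bool" where
  "purely_periodic_design d \<longleftrightarrow>
     infinite_design d \<and> (\<exists>P. P \<noteq> [] \<and> (\<forall>i. d i = P ! (i mod length P)))"

definition quadratic_irrational :: "real \<Rightarrow> bool" where
  "quadratic_irrational x \<longleftrightarrow>
     x \<notin> \<rat> \<and>
     (\<exists>a b c :: int. a \<noteq> 0 \<and> of_int a * x\<^sup>2 + of_int b * x + of_int c = 0)"

definition pure_quadratic_irrational :: "real \<Rightarrow> bool" where
  "pure_quadratic_irrational \<omega> \<longleftrightarrow>
     (\<exists>\<theta>\<in>{0..<1}. \<omega> = assembly \<theta> \<and>
        (\<exists>d. purely_periodic_design d \<and> \<theta> = design_decimal d))"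

definition nonpure_quadratic_irrational :: "real \<Rightarrow> bool" where
  "nonpure_quadratic_irrational \<omega> \<longleftrightarrow>
     quadratic_irrational \<omega> \<and> \<not> pure_quadratic_irrational \<omega>"

text \<open>\<open>cf_convergent a n\<close> is \<open>[a\<^sub>0; a\<^sub>1, \<dots>, a\<^sub>n]\<close>.\<close>
fun cf_convergent :: "(nat \<Rightarrow> int) \<Rightarrow> nat \<Rightarrow> real" where
  "cf_convergent a 0 = of_int (a 0)"
| "cf_convergent a (Suc n) = of_int (a 0) + 1 / cf_convergent (\<lambda>i. a (Suc i)) n"

definition infinite_scf_expansion :: "(nat \<Rightarrow> int) \<Rightarrow> real \<Rightarrow> bool" where
  "infinite_scf_expansion a x \<longleftrightarrow> (\<forall>i\<ge>1. a i \<ge> 1) \<and> cf_convergent a \<longlonglongrightarrow> x"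

text \<open>
  Only infinite expansions can be periodic; the infinite simple continued fraction expansion of a
  real number, if there is one, is unique.
\<close>
definition scf_purely_periodic :: "real \<Rightarrow> bool" where
  "scf_purely_periodic x \<longleftrightarrow>
     (\<exists>a. infinite_scf_expansion a x \<and> (\<exists>k\<ge>1. \<forall>i. a (i + k) = a i))"

end

theory Submission
  imports Defs "HOL-Number_Theory.Residues"
begin

text \<open>
  The assembly function conjugates the two inverse branches of the doubling map to Moebius maps:
  \<open>A (\<theta> / 2) = A \<theta> / (1 + A \<theta>)\<close> and \<open>A ((1 + \<theta>) / 2) = 1 + A \<theta>\<close>. If \<open>\<theta>\<close> is fixed by the
  contraction that prepends a binary word of length \<open>n\<close> and value \<open>m\<close>, that is, if
  \<open>\<theta> = m / (2 ^ n - 1)\<close>, then \<open>A \<theta>\<close> is fixed by a unimodular Moebius map and hence a root of an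
  integer quadratic. It is irrational unless \<open>\<theta>\<close> is dyadic, because \<open>A\<close> maps the dyadic numbers
  onto the nonnegative rationals. Grouping the word into runs of equal digits turns the Moebius map
  into a continued fraction whose partial quotients are the lengths of the runs; a word that starts
  with 1 and ends with 0 has an even number of runs and corresponds to a purely periodic expansion.
\<close>

section \<open>The assembly function\<close>

lemma stern_Suc_lower: "m \<le> 2 ^ n \<Longrightarrow> stern (Suc n) m = stern n m"
proof (induction n arbitrary: m)
  case 0
  then have "m = 0 \<or> m = 1" by auto
  then show ?case by auto
next
  case (Suc n)
  then have "m div 2 \<le> 2 ^ n" "odd m \<Longrightarrow> m div 2 + 1 \<le> 2 ^ n"
    by (auto elim!: oddE)
  with Suc.IH show ?case
    by (subst (1 2) stern.simps(2)) (auto simp del: stern.simps(2))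
qed

text \<open>Row \<open>n + 1\<close> starts with a copy of row \<open>n\<close>
  (\<open>stern_Suc_lower\<close>) and continues with the sum of row \<open>n\<close> and its mirror
  image. In the induction, an odd index has neighbours \<open>j\<close> and \<open>j + 1\<close>,
  and reflection merely swaps their roles. These two facts produce the two Moebius maps.\<close>

lemma stern_Suc_upper:
  "m \<le> 2 ^ n \<Longrightarrow> stern (Suc n) (2 ^ n + m) = stern n m + stern n (2 ^ n - m)"
proof (induction n arbitrary: m)
  case 0
  then have "m = 0 \<or> m = 1" by auto
  then show ?case by auto
next
  case (Suc n)
  show ?case
  proof (cases "even m")
    case True
    then obtain j where j: "m = 2 * j" by blast
    have e: "2 ^ Suc n + m = 2 * (2 ^ n + j)" "2 ^ Suc n - m = 2 * (2 ^ n - j)"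
      using j by auto
    have "j \<le> 2 ^ n" using Suc.prems j by simp
    then show ?thesis
      unfolding e using Suc.IH[of j] j by (simp only: stern_recursion)
  next
    case False
    then obtain j where j: "m = 2 * j + 1" by (auto elim: oddE)
    have le: "j + 1 \<le> 2 ^ n" using Suc.prems j by simp
    have e: "2 ^ Suc n + m = 2 * (2 ^ n + j) + 1" "2 ^ Suc n - m = 2 * (2 ^ n - (j + 1)) + 1"
      using j le by auto
    have "2 ^ n - (j + 1) + 1 = 2 ^ n - j" using le by simp
    then show ?thesis
      unfolding e using Suc.IH[of j] Suc.IH[of "j + 1"] j le
      by (simp only: stern_recursion) (simp add: add.assoc)
  qed
qed

lemma stern_pos: "0 < m \<Longrightarrow> m \<le> 2 ^ n \<Longrightarrow> 0 < stern n m"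
proof (induction n arbitrary: m)
  case (Suc n)
  show ?case
  proof (cases "even m")
    case True
    with Suc show ?thesis by (auto elim!: evenE)
  next
    case False
    then obtain j where j: "m = 2 * j + 1" by (auto elim: oddE)
    then have "0 < stern n (j + 1)" using Suc by (intro Suc.IH) auto
    then show ?thesis unfolding j stern_recursion by simp
  qed
qed auto

text \<open>The value prescribed for \<open>assembly\<close> at \<open>m / 2 ^ n\<close>. For
  \<open>m\<close> at least \<open>2 ^ n\<close> the denominator is 0 and the quotient defaults to
  0, so the bound \<open>m < 2 ^ n\<close> matters below.\<close>

definition stern_ratio :: "nat \<Rightarrow> nat \<Rightarrow> real" where
  "stern_ratio n m = real (stern n m) / real (stern n (2 ^ n - m))"

lemma stern_ratio_nonneg: "0 \<le> stern_ratio n m"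
  by (simp add: stern_ratio_def)

text \<open>Passing to the lower half of the next row keeps the numerator, while the denominator
  becomes the sum of the old numerator and denominator.\<close>

lemma stern_ratio_lower:
  assumes "m < 2 ^ n"
  shows "stern_ratio (Suc n) m = stern_ratio n m / (1 + stern_ratio n m)"
proof -
  have e: "2 ^ Suc n - m = 2 ^ n + (2 ^ n - m)" using assms by simp
  have "stern (Suc n) (2 ^ Suc n - m) = stern n (2 ^ n - m) + stern n m"
    unfolding e using stern_Suc_upper[of "2 ^ n - m" n] assms by simp
  moreover have "0 < stern n (2 ^ n - m)" using assms by (intro stern_pos) auto
  ultimately show ?thesis
    using stern_Suc_lower[of m n] assms
    by (simp add: stern_ratio_def field_simps del: stern.simps)
qed

lemma stern_ratio_upper:
  assumes "m < 2 ^ n"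
  shows "stern_ratio (Suc n) (2 ^ n + m) = 1 + stern_ratio n m"
proof -
  have e: "2 ^ Suc n - (2 ^ n + m) = 2 ^ n - m" by simp
  have "0 < stern n (2 ^ n - m)" using assms by (intro stern_pos) auto
  then show ?thesis
    unfolding stern_ratio_def e
    using stern_Suc_lower[of "2 ^ n - m" n] stern_Suc_upper[of m n] assms
    by (simp add: field_simps del: stern.simps)
qed

text \<open>Even indices copy the previous row, so the quotient depends only on the dyadic number
  and not on how it is written.\<close>

lemma stern_ratio_refine: "stern_ratio (n + k) (m * 2 ^ k) = stern_ratio n m"
proof (induction k)
  case (Suc k)
  have e: "m * 2 ^ Suc k = 2 * (m * 2 ^ k)"
    "2 ^ (n + Suc k) - m * 2 ^ Suc k = 2 * (2 ^ (n + k) - m * 2 ^ k)"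
    by (auto simp: algebra_simps)
  have "stern_ratio (n + Suc k) (m * 2 ^ Suc k) = stern_ratio (n + k) (m * 2 ^ k)"
    unfolding stern_ratio_def e(2) unfolding e(1) add_Suc_right stern_recursion by (rule refl)
  with Suc show ?case by simp
qed simp

lemma div_one_plus_strict_mono:
  fixes x y :: real
  shows "0 \<le> x \<Longrightarrow> x < y \<Longrightarrow> x / (1 + x) < y / (1 + y)"
  by (simp add: divide_simps algebra_simps)

text \<open>In the next row the lower half has quotients below 1 and the upper half quotients of at
  least 1; within each half an increasing map is applied to the quotients of row
  \<open>n\<close>.\<close>

lemma stern_ratio_strict_mono_same:
  "m < m' \<Longrightarrow> m' < 2 ^ n \<Longrightarrow> stern_ratio n m < stern_ratio n m'"
proof (induction n arbitrary: m m')
  case (Suc n)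
  consider "m' < 2 ^ n" | "m < 2 ^ n" "2 ^ n \<le> m'" | "2 ^ n \<le> m" by linarith
  then show ?case
  proof cases
    case 1
    with Suc show ?thesis
      by (simp add: stern_ratio_lower div_one_plus_strict_mono stern_ratio_nonneg)
  next
    case 2
    obtain j where j: "m' = 2 ^ n + j" using 2 le_Suc_ex by blast
    have "stern_ratio n m / (1 + stern_ratio n m) < 1"
      using stern_ratio_nonneg[of n m] by (simp add: divide_simps)
    moreover have "0 \<le> stern_ratio n j" by (rule stern_ratio_nonneg)
    ultimately show ?thesis
      using 2 Suc.prems j by (simp add: stern_ratio_lower stern_ratio_upper)
  next
    case 3
    obtain i where i: "m = 2 ^ n + i" using 3 le_Suc_ex by blast
    obtain j where j: "m' = 2 ^ n + j" using 3 Suc.prems le_Suc_ex[of "2 ^ n" m'] by auto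
    show ?thesis using i j Suc by (simp add: stern_ratio_upper)
  qed
qed simp

lemma stern_ratio_strict_mono:
  assumes "m' < 2 ^ n'" "real m / 2 ^ n < real m' / 2 ^ n'"
  shows "stern_ratio n m < stern_ratio n' m'"
proof -
  have "real m * 2 ^ n' < real m' * 2 ^ n"
    using assms(2) by (simp add: field_simps)
  then have "real (m * 2 ^ n') < real (m' * 2 ^ n)"
    unfolding of_nat_mult of_nat_power of_nat_numeral .
  then have lt: "m * 2 ^ n' < m' * 2 ^ n" unfolding of_nat_less_iff .
  have "m' * 2 ^ n < 2 ^ (n + n')"
    using assms(1) by (simp add: power_add mult.commute)
  with lt have "stern_ratio (n + n') (m * 2 ^ n') < stern_ratio (n + n') (m' * 2 ^ n)"
    by (intro stern_ratio_strict_mono_same)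
  then show ?thesis
    using stern_ratio_refine[of n n' m] stern_ratio_refine[of n' n m'] by (simp add: add.commute)
qed

lemma stern_ratio_mono:
  assumes "m' < 2 ^ n'" "real m / 2 ^ n \<le> real m' / 2 ^ n'"
  shows "stern_ratio n m \<le> stern_ratio n' m'"
proof (cases "real m / 2 ^ n = real m' / 2 ^ n'")
  case True
  then have "real m * 2 ^ n' = real m' * 2 ^ n"
    by (simp add: field_simps)
  then have "real (m * 2 ^ n') = real (m' * 2 ^ n)"
    unfolding of_nat_mult of_nat_power of_nat_numeral .
  then have "m * 2 ^ n' = m' * 2 ^ n" unfolding of_nat_eq_iff .
  then show ?thesis
    using stern_ratio_refine[of n n' m] stern_ratio_refine[of n' n m'] by (simp add: add.commute)
next
  case False
  with assms show ?thesis by (intro less_imp_le stern_ratio_strict_mono) auto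
qed

text \<open>This is the subtractive Euclidean algorithm: \<open>a / b\<close> below 1 arises from
  \<open>a / (b - a)\<close> by the lower branch, and otherwise from \<open>(a - b) / b\<close> by
  the upper branch.\<close>

lemma stern_ratio_surj_nat:
  "0 < b \<Longrightarrow> \<exists>n m. m < 2 ^ n \<and> stern_ratio n m = real a / real b"
proof (induction "a + b" arbitrary: a b rule: less_induct)
  case less
  consider "a = 0" | "0 < a" "a < b" | "b \<le> a" by linarith
  then show ?case
  proof cases
    case 1
    then show ?thesis by (intro exI[of _ 0]) (simp add: stern_ratio_def)
  next
    case 2
    then obtain n m where "m < 2 ^ n" "stern_ratio n m = real a / real (b - a)"
      using less.hyps[of a "b - a"] by auto
    moreover have "x / y / (1 + x / y) = x / (y + x)" if "0 < y" "0 < x" for x y :: real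
      using that by (simp add: divide_simps)
    ultimately have "stern_ratio (Suc n) m = real a / real b" "m < 2 ^ Suc n"
      using 2 by (auto simp: stern_ratio_lower of_nat_diff)
    then show ?thesis by blast
  next
    case 3
    then obtain n m where "m < 2 ^ n" "stern_ratio n m = real (a - b) / real b"
      using less.hyps[of "a - b" b] less.prems by auto
    with 3 less.prems have "stern_ratio (Suc n) (2 ^ n + m) = real a / real b" "2 ^ n + m < 2 ^ Suc n"
      by (auto simp: stern_ratio_upper of_nat_diff diff_divide_distrib)
    then show ?thesis by blast
  qed
qed

lemma stern_ratio_surj:
  assumes "x \<in> \<rat>" "0 \<le> x"
  shows "\<exists>n m. m < 2 ^ n \<and> stern_ratio n m = x"
proof -
  obtain a b :: nat where "b \<noteq> 0" "\<bar>x\<bar> = real a / real b"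
    using assms(1) by (rule Rats_abs_nat_div_natE)
  then show ?thesis using stern_ratio_surj_nat[of b a] assms(2) by auto
qed

section \<open>Density of the dyadic numbers\<close>

lemma dyadic_between:
  fixes x y :: real
  assumes "0 \<le> x" "x < y" "y \<le> 1"
  obtains n m :: nat where "m < 2 ^ n" "x < real m / 2 ^ n" "real m / 2 ^ n < y"
proof -
  obtain n where n: "1 / (y - x) < 2 ^ n" using real_arch_pow[of 2 "1 / (y - x)"] by auto
  define m where "m = nat \<lfloor>2 ^ n * x\<rfloor> + 1"
  have m: "real m = of_int \<lfloor>2 ^ n * x\<rfloor> + 1" using assms by (simp add: m_def)
  have "2 ^ n * x < real m" "real m \<le> 2 ^ n * x + 1" using m by linarith+
  moreover have "1 < 2 ^ n * (y - x)" using n assms by (simp add: field_simps)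
  ultimately have *: "2 ^ n * x < real m" "real m < 2 ^ n * y" by (auto simp: algebra_simps)
  have "2 ^ n * y \<le> 2 ^ n * (1::real)" using assms by (intro mult_left_mono) auto
  with * have "real m < real (2 ^ n)" unfolding of_nat_power of_nat_numeral by linarith
  then have "m < 2 ^ n" unfolding of_nat_less_iff .
  moreover have "x < real m / 2 ^ n" "real m / 2 ^ n < y"
    using * by (simp_all add: field_simps)
  ultimately show ?thesis by (rule that)
qed

lemma dyadic_unit_interval: "m < 2 ^ n \<Longrightarrow> real m / 2 ^ n \<in> {0..<1}"
  by (simp add: divide_simps)

lemma continuous_eq_on_dyadics:
  fixes f g :: "real \<Rightarrow> real"
  assumes f: "continuous_on {0..<1} f" and g: "continuous_on {0..<1} g"
    and eq: "\<And>n m. m < 2 ^ n \<Longrightarrow> f (real m / 2 ^ n) = g (real m / 2 ^ n)"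
    and x: "x \<in> {0..<1}"
  shows "f x = g x"
proof -
  \<comment> \<open>The points \<open>u n\<close> lie above \<open>x\<close>, do not exceed 1 and
    tend to \<open>x\<close>. Dyadic numbers squeezed between \<open>x\<close> and
    \<open>u n\<close> approach \<open>x\<close> from the right, which stays inside the domain even
    at \<open>x = 0\<close>.\<close>
  define u where "u n = x + (1 - x) / real (n + 2)" for n
  have "(1 - x) / real (n + 2) \<le> (1 - x) / 1" for n
    using x by (intro divide_left_mono) auto
  then have u: "x < u n" "u n \<le> 1" for n
    using x by (auto simp: u_def field_simps)
  have "0 \<le> x" using x by simp
  have "\<exists>d. d \<in> {0..<1} \<and> x < d \<and> d < u n \<and> f d = g d" for n
    by (rule dyadic_between[OF \<open>0 \<le> x\<close> u[of n]]) (use eq dyadic_unit_interval in blast)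
  then obtain d where d: "\<And>n. d n \<in> {0..<1}" "\<And>n. x < d n" "\<And>n. d n < u n" "\<And>n. f (d n) = g (d n)"
    by metis
  have "(\<lambda>n. (1 - x) / real (n + 2)) \<longlonglongrightarrow> 0"
    using LIMSEQ_ignore_initial_segment[OF lim_const_over_n[of "1 - x"], of 2] by simp
  then have "u \<longlonglongrightarrow> x + 0" unfolding u_def by (intro tendsto_add tendsto_const)
  then have u_lim: "u \<longlonglongrightarrow> x" by simp
  have "d \<longlonglongrightarrow> x"
    by (intro tendsto_sandwich[OF _ _ tendsto_const u_lim] always_eventually allI less_imp_le d)
  then have "(\<lambda>n. f (d n)) \<longlonglongrightarrow> f x" "(\<lambda>n. g (d n)) \<longlonglongrightarrow> g x"
    by (rule continuous_on_tendsto_compose[OF f] continuous_on_tendsto_compose[OF g];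
      use x d(1) in simp)+
  with d(4) show ?thesis by (simp add: LIMSEQ_unique)
qed

section \<open>Existence and uniqueness of the assembly function\<close>

definition is_assembly :: "(real \<Rightarrow> real) \<Rightarrow> bool" where
  "is_assembly f \<longleftrightarrow>
     (\<forall>n m. m < 2 ^ n \<longrightarrow>
        f (real m / 2 ^ n) = real (stern n m) / real (stern n (2 ^ n - m))) \<and>
     continuous_on {0..<1} f \<and>
     strict_mono_on {0..<1} f \<and>
     bij_betw f {0..<1} {0..} \<and>
     (\<forall>x. x \<notin> {0..<1} \<longrightarrow> f x = 0)"

lemma is_assemblyD:
  assumes "is_assembly f"
  shows is_assembly_dyadic: "m < 2 ^ n \<Longrightarrow> f (real m / 2 ^ n) = stern_ratio n m"
    and is_assembly_continuous: "continuous_on {0..<1} f"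
    and is_assembly_strict_mono: "strict_mono_on {0..<1} f"
    and is_assembly_bij: "bij_betw f {0..<1} {0..}"
    and is_assembly_outside: "x \<notin> {0..<1} \<Longrightarrow> f x = 0"
  using assms unfolding is_assembly_def stern_ratio_def by blast+

lemma is_assembly_unique:
  assumes "is_assembly f" "is_assembly g"
  shows "f = g"
proof
  fix x
  show "f x = g x"
  proof (cases "x \<in> {0..<1}")
    case True
    show ?thesis
      by (rule continuous_eq_on_dyadics[OF is_assembly_continuous[OF assms(1)]
            is_assembly_continuous[OF assms(2)] _ True])
        (simp only: is_assembly_dyadic[OF assms(1)] is_assembly_dyadic[OF assms(2)])
  next
    case False
    then show ?thesis by (simp only: is_assembly_outside[OF assms(1) False] is_assembly_outside[OF assms(2) False])
  qed
qed

text \<open>A monotone function can only be discontinuous by jumping, and a jump would leave a gap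
  in the image.\<close>

lemma mono_onto_imp_continuous_on:
  fixes f :: "real \<Rightarrow> real"
  assumes mono: "strict_mono_on {0..<1} f" and surj: "f ` {0..<1} = {0..}"
  shows "continuous_on {0..<1} f"
proof -
  \<comment> \<open>Gluing the identity on the negative reals makes the image open.\<close>
  define g where "g x = (if x < 0 then x else f x)" for x
  have nonneg: "0 \<le> f x" if "x \<in> {0..<1}" for x using surj that by auto
  have "g ` {..<1} = UNIV"
  proof (intro equalityI subsetI)
    fix y :: real
    show "y \<in> g ` {..<1}"
    proof (cases "y < 0")
      case True
      then show ?thesis by (intro image_eqI[of _ _ y]) (auto simp: g_def)
    next
      case False
      then have "y \<in> f ` {0..<1}" using surj by auto
      then show ?thesis by (auto simp: g_def)
    qed
  qed simp
  moreover have "g x \<le> g y" if "x \<in> {..<1}" "y \<in> {..<1}" "x \<le> y" for x y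
  proof -
    consider "y < 0" | "x < 0" "0 \<le> y" | "0 \<le> x" by linarith
    then show ?thesis
    proof cases
      case 2
      then show ?thesis using nonneg[of y] that by (auto simp: g_def)
    next
      case 3
      then show ?thesis using that mono strict_mono_onD[OF mono, of x y]
        by (cases "x = y") (auto simp: g_def)
    qed (use that in \<open>auto simp: g_def\<close>)
  qed
  ultimately have "continuous_on {..<1} g" by (intro continuous_onI_mono) auto
  then have "continuous_on {0..<1} g" by (rule continuous_on_subset) auto
  then show ?thesis by (rule continuous_on_eq) (simp add: g_def)
qed

text \<open>The extension takes at \<open>x\<close> the supremum of the values at dyadic numbers up
  to \<open>x\<close>. Density makes it strictly increasing; it is onto because every nonnegative
  rational is already a dyadic value, and continuity follows from being onto.\<close>

lemma is_assembly_exists: "\<exists>f. is_assembly f"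
proof -
  define B where "B x = {stern_ratio n m | n m. m < 2 ^ n \<and> real m / 2 ^ n \<le> x}" for x
  define f where "f x = (if x \<in> {0..<1} then Sup (B x) else 0)" for x
  have ne: "B x \<noteq> {}" if "x \<in> {0..<1}" for x
  proof -
    have "stern_ratio 0 0 \<in> B x" unfolding B_def using that by force
    then show ?thesis by blast
  qed
  have bound: "y \<le> stern_ratio n m" if "y \<in> B x" "m < 2 ^ n" "x \<le> real m / 2 ^ n" for x y n m
    using that unfolding B_def by (force intro: stern_ratio_mono)
  have bdd: "bdd_above (B x)" if "x \<in> {0..<1}" for x
    by (rule dyadic_between[of x 1]) (use that in \<open>auto intro!: bdd_aboveI bound\<close>)
  have le: "f x \<le> stern_ratio n m" if "x \<in> {0..<1}" "m < 2 ^ n" "x \<le> real m / 2 ^ n" for x n m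
    using that bound ne by (auto simp: f_def intro!: cSup_least)
  have ge: "stern_ratio n m \<le> f x" if "x \<in> {0..<1}" "m < 2 ^ n" "real m / 2 ^ n \<le> x" for x n m
    using that bdd by (auto simp: f_def B_def intro!: cSup_upper)
  have dy: "f (real m / 2 ^ n) = stern_ratio n m" if "m < 2 ^ n" for n m
    using le[OF dyadic_unit_interval, OF that that] ge[OF dyadic_unit_interval, OF that that] by auto
  have mono: "strict_mono_on {0..<1} f"
  proof (rule strict_mono_onI)
    fix x y :: real
    assume xy: "x \<in> {0..<1}" "y \<in> {0..<1}" "x < y"
    \<comment> \<open>Comparing \<open>f\<close> with a dyadic value gives only weak inequalities,
      so two dyadic points between \<open>x\<close> and \<open>y\<close> are used and the strict
      step happens between them.\<close>
    obtain n m where nm: "m < 2 ^ n" "x < real m / 2 ^ n" "real m / 2 ^ n < y"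
      by (rule dyadic_between[of x y]) (use xy in auto)
    obtain n' m' where nm': "m' < 2 ^ n'" "real m / 2 ^ n < real m' / 2 ^ n'" "real m' / 2 ^ n' < y"
      by (rule dyadic_between[of "real m / 2 ^ n" y]) (use nm xy in auto)
    have "f x \<le> stern_ratio n m" using xy nm by (intro le) auto
    also have "\<dots> < stern_ratio n' m'" using nm' by (intro stern_ratio_strict_mono)
    also have "\<dots> \<le> f y" using xy nm' by (intro ge) auto
    finally show "f x < f y" .
  qed
  have "f ` {0..<1} = {0..}"
  proof (intro equalityI subsetI)
    fix y assume "y \<in> f ` {0..<1}"
    then obtain x where x: "x \<in> {0..<1}" "y = f x" by blast
    then show "y \<in> {0..}"
      using ge[of x 0 0] stern_ratio_nonneg[of 0 0] by auto
  next
    fix y :: real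
    assume "y \<in> {0..}"
    then have y: "0 \<le> y" by simp
    \<comment> \<open>The candidate preimage of \<open>y\<close> is the supremum of the dyadic
      points whose value does not exceed \<open>y\<close>.\<close>
    define C where "C = {real m / 2 ^ n | n m. m < 2 ^ n \<and> stern_ratio n m \<le> y}"
    define x where "x = Sup C"
    \<comment> \<open>A rational above \<open>y\<close> is the value at some dyadic point below 1;
      this point bounds \<open>C\<close> and keeps its supremum below 1.\<close>
    obtain r where r: "r \<in> \<rat>" "y < r" using Rats_dense_in_real[of y "y + 1"] by auto
    obtain N M where NM: "M < 2 ^ N" "stern_ratio N M = r"
      using stern_ratio_surj[of r] r y by auto
    have Cub: "c \<le> real m / 2 ^ n" if "c \<in> C" "m < 2 ^ n" "y < stern_ratio n m" for c n m
    proof (rule ccontr)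
      assume "\<not> c \<le> real m / 2 ^ n"
      moreover obtain n' m' where "c = real m' / 2 ^ n'" "m' < 2 ^ n'" "stern_ratio n' m' \<le> y"
        using \<open>c \<in> C\<close> by (auto simp: C_def)
      ultimately show False using stern_ratio_strict_mono[of m' n' m n] that by auto
    qed
    have 0: "0 \<in> C" unfolding C_def using y
      by (intro CollectI exI[of _ 0]) (simp add: stern_ratio_def)
    have bddC: "bdd_above C" using Cub[OF _ NM(1)] NM r by (intro bdd_aboveI) auto
    have x0: "0 \<le> x" unfolding x_def using 0 bddC by (rule cSup_upper)
    have "x \<le> real M / 2 ^ N" unfolding x_def using 0 Cub NM r by (intro cSup_least) auto
    also have "\<dots> < 1" using NM(1) by simp
    finally have x: "x \<in> {0..<1}" using x0 by simp
    \<comment> \<open>A rational strictly between \<open>f x\<close> and \<open>y\<close> would be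
      the value at some dyadic point; comparing that point with the supremum of \<open>C\<close>
      puts \<open>f x\<close> on the wrong side of the rational.\<close>
    have "f x = y"
    proof (rule linorder_cases[of "f x" y])
      assume "f x < y"
      then obtain r where r: "r \<in> \<rat>" "f x < r" "r < y" using Rats_dense_in_real by blast
      have "0 \<le> f x" using ge[of x 0 0] x stern_ratio_nonneg[of 0 0] by auto
      then obtain n m where nm: "m < 2 ^ n" "stern_ratio n m = r"
        using stern_ratio_surj[of r] r by auto
      then have "real m / 2 ^ n \<in> C" unfolding C_def using r by force
      then have "real m / 2 ^ n \<le> x" unfolding x_def using bddC by (rule cSup_upper)
      then have "r \<le> f x" using ge[OF x nm(1)] nm by simp
      with r show ?thesis by simp
    next
      assume "y < f x"
      then obtain r where r: "r \<in> \<rat>" "y < r" "r < f x" using Rats_dense_in_real by blast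
      then obtain n m where nm: "m < 2 ^ n" "stern_ratio n m = r"
        using stern_ratio_surj[of r] y by auto
      have "x \<le> real m / 2 ^ n" unfolding x_def using 0 Cub nm r by (intro cSup_least) auto
      then have "f x \<le> r" using le[OF x nm(1)] nm by simp
      with r show ?thesis by simp
    qed
    with x show "y \<in> f ` {0..<1}" by blast
  qed
  note surj = this
  have "is_assembly f"
    unfolding is_assembly_def stern_ratio_def[symmetric]
  proof (intro conjI allI impI)
    show "continuous_on {0..<1} f" using mono surj by (rule mono_onto_imp_continuous_on)
    show "bij_betw f {0..<1} {0..}"
      using strict_mono_on_imp_inj_on[OF mono] surj by (rule bij_betw_imageI)
    show "f x = 0" if "x \<notin> {0..<1}" for x using that unfolding f_def by (rule if_not_P)
  qed (fact dy mono)+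
  then show ?thesis by (rule exI[of _ f])
qed

lemma is_assembly_assembly: "is_assembly assembly"
proof -
  have eq: "assembly = (THE f. is_assembly f)" unfolding assembly_def is_assembly_def by (rule refl)
  have "\<exists>!f. is_assembly f" using is_assembly_exists is_assembly_unique by blast
  then show ?thesis unfolding eq by (rule theI')
qed

section \<open>Rational values and functional equations of the assembly function\<close>

lemmas assembly_dyadic = is_assembly_dyadic[OF is_assembly_assembly]
  and assembly_continuous = is_assembly_continuous[OF is_assembly_assembly]
  and assembly_strict_mono = is_assembly_strict_mono[OF is_assembly_assembly]
  and assembly_inj = bij_betw_imp_inj_on[OF is_assembly_bij[OF is_assembly_assembly]]

lemma assembly_nonneg: "x \<in> {0..<1} \<Longrightarrow> 0 \<le> assembly x"
  using bij_betwE[OF is_assembly_bij[OF is_assembly_assembly]] by simp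

lemma assembly_pos: "x \<in> {0..<1} \<Longrightarrow> 0 < x \<Longrightarrow> 0 < assembly x"
  using strict_mono_onD[OF assembly_strict_mono, of 0 x] assembly_nonneg[of 0] by auto

text \<open>Dyadic points already take every nonnegative rational value, so injectivity leaves no
  room for another preimage.\<close>

lemma assembly_rational_imp_dyadic:
  assumes "x \<in> {0..<1}" "assembly x \<in> \<rat>"
  obtains n m :: nat where "x = real m / 2 ^ n"
proof -
  obtain n m where nm: "m < 2 ^ n" "stern_ratio n m = assembly x"
    using stern_ratio_surj[OF assms(2) assembly_nonneg[OF assms(1)]] by blast
  then have "assembly x = assembly (real m / 2 ^ n)" by (simp add: assembly_dyadic)
  then have "x = real m / 2 ^ n"
    using inj_onD[OF assembly_inj] assms(1) dyadic_unit_interval[OF nm(1)] by blast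
  then show ?thesis by (rule that)
qed

text \<open>Both sides are continuous, so it suffices to compare them at dyadic points, where
  \<open>stern_ratio_lower\<close> applies. The other branch is treated in the same way with
  \<open>stern_ratio_upper\<close>.\<close>

lemma assembly_half:
  assumes "x \<in> {0..<1}"
  shows "assembly (x / 2) = assembly x / (1 + assembly x)"
proof (rule continuous_eq_on_dyadics[OF _ _ _ assms])
  have "(\<lambda>x::real. x / 2) ` {0..<1} \<subseteq> {0..<1}" by auto
  then show "continuous_on {0..<1} (\<lambda>x. assembly (x / 2))"
    by (intro continuous_on_compose2[OF assembly_continuous] continuous_intros) auto
  show "continuous_on {0..<1} (\<lambda>x. assembly x / (1 + assembly x))"
    by (intro continuous_intros assembly_continuous) (metis add_pos_nonneg assembly_nonneg less_irrefl zero_less_one)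
  fix n m :: nat
  assume m: "m < 2 ^ n"
  have "assembly (real m / 2 ^ n / 2) = stern_ratio (Suc n) m"
    using assembly_dyadic[of m "Suc n"] m by (simp add: mult.commute)
  with m show "assembly (real m / 2 ^ n / 2) =
      assembly (real m / 2 ^ n) / (1 + assembly (real m / 2 ^ n))"
    by (simp add: assembly_dyadic stern_ratio_lower)
qed

lemma assembly_half_plus:
  assumes "x \<in> {0..<1}"
  shows "assembly ((1 + x) / 2) = 1 + assembly x"
proof (rule continuous_eq_on_dyadics[OF _ _ _ assms])
  have "(\<lambda>x::real. (1 + x) / 2) ` {0..<1} \<subseteq> {0..<1}" by auto
  then show "continuous_on {0..<1} (\<lambda>x. assembly ((1 + x) / 2))"
    by (intro continuous_on_compose2[OF assembly_continuous] continuous_intros) auto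
  show "continuous_on {0..<1} (\<lambda>x. 1 + assembly x)"
    by (intro continuous_intros assembly_continuous)
  fix n m :: nat
  assume m: "m < 2 ^ n"
  have e: "(1 + real m / 2 ^ n) / 2 = real (2 ^ n + m) / 2 ^ Suc n"
    by (simp add: field_simps)
  have "assembly ((1 + real m / 2 ^ n) / 2) = stern_ratio (Suc n) (2 ^ n + m)"
    unfolding e by (rule assembly_dyadic) (use m in simp)
  with m show "assembly ((1 + real m / 2 ^ n) / 2) = 1 + assembly (real m / 2 ^ n)"
    by (simp add: assembly_dyadic stern_ratio_upper)
qed

section \<open>Binary words acting on both sides of the assembly function\<close>

fun word_val :: "bool list \<Rightarrow> nat" where
  "word_val [] = 0"
| "word_val (b # w) = of_bool b * 2 ^ length w + word_val w"

text \<open>Prepends the digits of the word to a binary expansion of \<open>t\<close>.\<close>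

fun word_map :: "bool list \<Rightarrow> real \<Rightarrow> real" where
  "word_map [] t = t"
| "word_map (b # w) t = (of_bool b + word_map w t) / 2"

text \<open>The same composition as \<open>word_map\<close>, again with the head of the word
  outermost, after transport by \<open>assembly\<close>; see
  \<open>assembly_word_map\<close>.\<close>

fun word_moebius :: "bool list \<Rightarrow> real \<Rightarrow> real" where
  "word_moebius [] x = x"
| "word_moebius (b # w) x =
     (if b then 1 + word_moebius w x else word_moebius w x / (1 + word_moebius w x))"

lemma word_map_eq: "word_map w t = (t + real (word_val w)) / 2 ^ length w"
  by (induction w) (auto simp: field_simps)

lemma word_val_less: "word_val w < 2 ^ length w"
  by (induction w) auto

lemma word_map_unit: "t \<in> {0..<1} \<Longrightarrow> word_map w t \<in> {0..<1}"
  by (induction w) auto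

lemma word_moebius_pos: "0 < x \<Longrightarrow> 0 < word_moebius w x"
  by (induction w) (auto intro: divide_pos_pos add_pos_pos)

lemma assembly_word_map:
  assumes "t \<in> {0..<1}"
  shows "assembly (word_map w t) = word_moebius w (assembly t)"
proof (induction w)
  case (Cons b w)
  have "word_map w t \<in> {0..<1}" by (rule word_map_unit) fact
  with Cons show ?case by (cases b) (simp_all only: assembly_half assembly_half_plus
    word_map.simps word_moebius.simps of_bool_eq if_True if_False add_0)
qed simp

lemma two_power_gt_1: "w \<noteq> [] \<Longrightarrow> (1::real) < 2 ^ length w"
  by (intro one_less_power) auto

text \<open>The fixed point equation is linear in \<open>t\<close> with leading coefficient
  \<open>2 ^ length w - 1\<close>; this is the origin of the denominators in the theorem.\<close>

lemma word_map_fixed_iff: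
  assumes "w \<noteq> []"
  shows "word_map w t = t \<longleftrightarrow> t = real (word_val w) / (2 ^ length w - 1)"
  using two_power_gt_1[OF assms] by (auto simp: word_map_eq field_simps)

lemma word_val_surj: "m < 2 ^ n \<Longrightarrow> \<exists>w. length w = n \<and> word_val w = m"
proof (induction n arbitrary: m)
  case (Suc n)
  obtain w where w: "length w = n" "word_val w = m mod 2 ^ n"
    using Suc.IH[of "m mod 2 ^ n"] by auto
  have "m div 2 ^ n < 2" using Suc.prems by (simp add: less_mult_imp_div_less)
  then have "m div 2 ^ n = of_bool (m div 2 ^ n = 1)" by auto
  then have "m = of_bool (m div 2 ^ n = 1) * 2 ^ n + m mod 2 ^ n"
    by (metis div_mult_mod_eq)
  then have "word_val ((m div 2 ^ n = 1) # w) = m" using w by simp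
  with w show ?case by (metis length_Cons)
qed auto

lemma even_word_val_iff: "w \<noteq> [] \<Longrightarrow> even (word_val w) \<longleftrightarrow> \<not> last w"
  by (induction w) auto

lemma hd_word_iff: "w \<noteq> [] \<Longrightarrow> hd w \<longleftrightarrow> 2 ^ (length w - 1) \<le> word_val w"
  using word_val_less[of "tl w"] by (cases w) auto

lemma word_val_eq_0_iff: "word_val w = 0 \<longleftrightarrow> True \<notin> set w"
  by (induction w) auto

lemma word_val_maximal_iff: "Suc (word_val w) = 2 ^ length w \<longleftrightarrow> False \<notin> set w"
proof (induction w)
  case (Cons b w)
  then show ?case using word_val_less[of w] by (cases b) auto
qed simp

section \<open>Periodic designs and their decimals\<close>

lemma summable_design: "summable (\<lambda>i. of_bool (d i) / 2 ^ Suc i :: real)"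
proof (rule summable_comparison_test)
  show "summable (\<lambda>i. (1 / 2 :: real) ^ i)" by (rule summable_geometric) simp
  show "\<exists>N. \<forall>n\<ge>N. norm (of_bool (d n) / 2 ^ Suc n :: real) \<le> (1 / 2) ^ n"
    by (auto simp: power_divide divide_simps)
qed

lemma design_decimal_shift:
  "design_decimal d = (of_bool (d 0) + design_decimal (\<lambda>i. d (Suc i))) / 2"
proof -
  have "(\<Sum>i. of_bool (d (Suc i)) / 2 ^ Suc (Suc i) :: real) =
      (\<Sum>i. of_bool (d (Suc i)) / 2 ^ Suc i / 2)"
    by (intro suminf_cong) (simp add: field_simps)
  also have "\<dots> = design_decimal (\<lambda>i. d (Suc i)) / 2"
    unfolding design_decimal_def by (intro suminf_divide summable_design)
  finally show ?thesis
    using suminf_split_head[OF summable_design[of d]] by (simp add: design_decimal_def)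
qed

lemma design_decimal_prefix:
  "(\<And>i. i < length w \<Longrightarrow> d i = w ! i) \<Longrightarrow>
     design_decimal d = word_map w (design_decimal (\<lambda>i. d (i + length w)))"
proof (induction w arbitrary: d)
  case (Cons b w)
  have "design_decimal (\<lambda>i. d (Suc i)) = word_map w (design_decimal (\<lambda>i. d (Suc (i + length w))))"
    by (rule Cons.IH) (use Cons.prems[of "Suc _"] in auto)
  moreover have "d 0 = b" using Cons.prems[of 0] by simp
  ultimately show ?case using design_decimal_shift[of d] by simp
qed simp

text \<open>Dropping one period does not change the sequence, so its decimal is a fixed point of
  \<open>word_map w\<close>.\<close>

lemma design_decimal_periodic:
  assumes "w \<noteq> []" "\<And>i. d i = w ! (i mod length w)"
  shows "design_decimal d = real (word_val w) / (2 ^ length w - 1)"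
proof -
  have "(\<lambda>i. d (i + length w)) = d" using assms(2) by auto
  then have "design_decimal d = word_map w (design_decimal d)"
    using design_decimal_prefix[of w d] assms(2) by auto
  then show ?thesis using word_map_fixed_iff[OF assms(1), of "design_decimal d"] by simp
qed

text \<open>Every digit of the period recurs forever, so a constant tail forces the whole period to
  be constant.\<close>

lemma infinite_design_periodic_iff:
  assumes "w \<noteq> []" "\<And>i. d i = w ! (i mod length w)"
  shows "infinite_design d \<longleftrightarrow> True \<in> set w \<and> False \<in> set w"
proof -
  have *: "(\<exists>N. \<forall>i\<ge>N. d i = b) \<longleftrightarrow> (\<not> b) \<notin> set w" for b
  proof
    assume "\<exists>N. \<forall>i\<ge>N. d i = b"
    then obtain N where N: "\<And>i. i \<ge> N \<Longrightarrow> d i = b" by blast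
    show "(\<not> b) \<notin> set w"
    proof
      assume "(\<not> b) \<in> set w"
      then obtain j where j: "j < length w" "w ! j = (\<not> b)" by (auto simp: in_set_conv_nth)
      \<comment> \<open>Moving \<open>j\<close> on by \<open>N\<close> whole periods takes it to
        \<open>N\<close> or beyond without changing the digit.\<close>
      have "1 \<le> length w" using assms(1) by (simp add: Suc_le_eq)
      then have "N * 1 \<le> N * length w" by (rule mult_le_mono2)
      then have "d (j + N * length w) = b" by (intro N) linarith
      moreover have "d (j + N * length w) = w ! j" using assms(2) j by simp
      ultimately show False using j by simp
    qed
  next
    assume nb: "(\<not> b) \<notin> set w"
    have "d i = b" for i
    proof (rule ccontr)
      assume "d i \<noteq> b"
      then have "(\<not> b) = d i" by blast
      moreover have "d i \<in> set w" using assms by simp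
      ultimately show False using nb by (simp only: not_True_eq_False)
    qed
    then show "\<exists>N. \<forall>i\<ge>N. d i = b" by blast
  qed
  show ?thesis unfolding infinite_design_def ex_bool_eq * by auto
qed

text \<open>A word of length \<open>n\<close> has value 0 or \<open>2 ^ n - 1\<close> exactly when
  its digits are constant, and these are the periods that give no infinite design. All other values
  give one.\<close>

lemma periodic_design_decimal_iff:
  "(\<exists>d. purely_periodic_design d \<and> t = design_decimal d) \<longleftrightarrow>
   (\<exists>(n::nat) (m::int). 1 \<le> m \<and> m \<le> 2 ^ n - 2 \<and> t = of_int m / (2 ^ n - 1))"
proof safe
  fix d
  assume "purely_periodic_design d"
  then obtain w where w: "infinite_design d" "w \<noteq> []" "\<And>i. d i = w ! (i mod length w)"
    by (auto simp: purely_periodic_design_def)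
  then have "True \<in> set w" "False \<in> set w" using infinite_design_periodic_iff[of w d] by auto
  then have "word_val w \<noteq> 0" "Suc (word_val w) \<noteq> 2 ^ length w"
    using word_val_eq_0_iff word_val_maximal_iff by auto
  then have "1 \<le> word_val w" "word_val w + 2 \<le> 2 ^ length w"
    using word_val_less[of w] by auto
  then have "1 \<le> int (word_val w)" "int (word_val w + 2) \<le> int (2 ^ length w)"
    by (simp, simp only: of_nat_le_iff)
  then have "1 \<le> int (word_val w)" "int (word_val w) \<le> 2 ^ length w - 2" by simp_all
  then show "\<exists>(n::nat) (m::int). 1 \<le> m \<and> m \<le> 2 ^ n - 2 \<and> design_decimal d = of_int m / (2 ^ n - 1)"
    using design_decimal_periodic[OF w(2,3)]
    by (intro exI[of _ "length w"] exI[of _ "int (word_val w)"]) simp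
next
  fix n :: nat and m :: int
  assume m: "1 \<le> m" "m \<le> 2 ^ n - 2"
  have lt: "int (nat m) < int (2 ^ n)" using m by simp
  then obtain w where w: "length w = n" "word_val w = nat m"
    using word_val_surj[of "nat m" n] unfolding of_nat_less_iff by blast
  have "int (Suc (nat m)) \<noteq> int (2 ^ n)" using m by simp
  then have "Suc (nat m) \<noteq> 2 ^ n" unfolding of_nat_eq_iff .
  then have "True \<in> set w" "False \<in> set w"
    using word_val_eq_0_iff[of w] word_val_maximal_iff[of w] w m by auto
  moreover define d where "d i = w ! (i mod length w)" for i
  moreover have "w \<noteq> []" using \<open>True \<in> set w\<close> by auto
  ultimately have "purely_periodic_design d"
    using infinite_design_periodic_iff[of w d] by (auto simp: purely_periodic_design_def)
  moreover have "design_decimal d = of_int m / (2 ^ n - 1)"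
    using design_decimal_periodic[OF \<open>w \<noteq> []\<close> d_def] w m by simp
  ultimately show "\<exists>d. purely_periodic_design d \<and> of_int m / (2 ^ n - 1) = design_decimal d"
    by metis
qed

text \<open>By injectivity, the argument quantified in the definition of purity must be
  \<open>t\<close> itself.\<close>

lemma pure_quadratic_irrational_iff:
  assumes "t \<in> {0..<1}"
  shows "pure_quadratic_irrational (assembly t) \<longleftrightarrow>
    (\<exists>(n::nat) (m::int). 1 \<le> m \<and> m \<le> 2 ^ n - 2 \<and> t = of_int m / (2 ^ n - 1))"
  unfolding periodic_design_decimal_iff[symmetric] pure_quadratic_irrational_def
  using inj_onD[OF assembly_inj] assms by blast

section \<open>Quadratic irrationality\<close>

text \<open>Each digit adds one row of the matrix to the other, which preserves determinant 1 and
  increases the sum of the entries. The lower bound on that sum serves to rule out the identity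
  matrix for nonempty words.\<close>

lemma word_moebius_matrix:
  "\<exists>a b c e :: nat. length w + 2 \<le> a + b + c + e \<and> a * e = b * c + 1 \<and>
     (\<forall>x::real. 0 \<le> x \<longrightarrow> word_moebius w x = (a * x + b) / (c * x + e))"
proof (induction w)
  case Nil
  show ?case by (rule exI[of _ 1], rule exI[of _ 0], rule exI[of _ 0], rule exI[of _ 1]) simp
next
  case (Cons d w)
  then obtain a b c e :: nat where h: "length w + 2 \<le> a + b + c + e" "a * e = b * c + 1"
    "\<And>x::real. 0 \<le> x \<Longrightarrow> word_moebius w x = (a * x + b) / (c * x + e)" by blast
  have pos: "0 < a" "0 < e" using h(2) by (auto intro: Nat.gr0I)
  have den: "0 < c * x + e" if "0 \<le> x" for x :: real using that pos by (simp add: add_nonneg_pos)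
  show ?case
  proof (cases d)
    case True
    have "word_moebius (d # w) x = (real (a + c) * x + real (b + e)) / (c * x + e)" if "0 \<le> x" for x :: real
      using h(3)[OF that] den[OF that] True by (simp add: field_simps)
    moreover have "length (d # w) + 2 \<le> (a + c) + (b + e) + c + e" using h(1) pos by simp
    moreover have "(a + c) * e = (b + e) * c + 1" using h(2) by (simp add: algebra_simps)
    ultimately show ?thesis by blast
  next
    case False
    have "word_moebius (d # w) x = (a * x + b) / (real (a + c) * x + real (b + e))" if "0 \<le> x" for x :: real
    proof -
      have *: "u / v / (1 + u / v) = u / (u + v)" if "0 < v" for u v :: real
        using that by (simp add: divide_simps add.commute)
      have "word_moebius (d # w) x = (a * x + b) / ((a * x + b) + (c * x + e))"
        using h(3)[OF that] *[OF den[OF that]] False by simp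
      then show ?thesis by (simp add: algebra_simps)
    qed
    moreover have "length (d # w) + 2 \<le> a + b + (a + c) + (b + e)" using h(1) pos by simp
    moreover have "a * (b + e) = b * (a + c) + 1" using h(2) by (simp add: algebra_simps)
    ultimately show ?thesis by blast
  qed
qed

lemma quadratic_irrational_fixed_point:
  assumes "w \<noteq> []" "0 \<le> x" "word_moebius w x = x" "x \<notin> \<rat>"
  shows "quadratic_irrational x"
proof -
  obtain a b c e :: nat where h: "length w + 2 \<le> a + b + c + e" "a * e = b * c + 1"
    "word_moebius w x = (a * x + b) / (c * x + e)"
    using word_moebius_matrix[of w] assms(2) by blast
  have "0 < e" using h(2) by (auto intro: Nat.gr0I)
  then have "0 < c * x + e" using assms(2) by (simp add: add_nonneg_pos)
  then have eq: "x * (c * x + e) = a * x + b" using h(3) assms(3) by (simp add: field_simps)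
  \<comment> \<open>If \<open>c = 0\<close>, then determinant 1 and the fixed point equation force
    the identity matrix, whose entries sum to 2; a nonempty word gives at least 3.\<close>
  have "c \<noteq> 0"
  proof
    assume "c = 0"
    with h(2) have "a = 1" "e = 1" by auto
    with eq \<open>c = 0\<close> have "b = 0" by simp
    with h(1) \<open>a = 1\<close> \<open>e = 1\<close> \<open>c = 0\<close> assms(1) show False by simp
  qed
  moreover have "of_int (int c) * x\<^sup>2 + of_int (int e - int a) * x + of_int (- int b) = 0"
    using eq by (simp add: algebra_simps power2_eq_square)
  ultimately show ?thesis unfolding quadratic_irrational_def using assms(4)
    by (metis of_nat_eq_0_iff)
qed

lemma quadratic_irrational_add_1:
  assumes "quadratic_irrational x"
  shows "quadratic_irrational (1 + x)"
proof -
  obtain a b c :: int where h: "a \<noteq> 0" "of_int a * x\<^sup>2 + of_int b * x + of_int c = 0" "x \<notin> \<rat>"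
    using assms by (auto simp: quadratic_irrational_def)
  have "1 + x \<notin> \<rat>" using h(3) Rats_diff[of "1 + x" 1] by auto
  moreover have "of_int a * (1 + x)\<^sup>2 + of_int (b - 2 * a) * (1 + x) + of_int (a - b + c) = 0"
    using h(2) by (simp add: algebra_simps power2_eq_square)
  ultimately show ?thesis unfolding quadratic_irrational_def using h(1) by blast
qed

lemma quadratic_irrational_div_1_plus:
  assumes "quadratic_irrational x" "0 < x"
  shows "quadratic_irrational (x / (1 + x))"
proof -
  obtain a b c :: int where h: "a \<noteq> 0" "of_int a * x\<^sup>2 + of_int b * x + of_int c = 0" "x \<notin> \<rat>"
    using assms(1) by (auto simp: quadratic_irrational_def)
  define y where "y = x / (1 + x)"
  have x: "x = y / (1 - y)" "y \<noteq> 1" "1 - y = 1 / (1 + x)"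
    using assms(2) by (auto simp: y_def divide_simps algebra_simps)
  have "y \<notin> \<rat>" using h(3) x(1) by (metis Rats_1 Rats_diff Rats_divide)
  \<comment> \<open>Substitute \<open>x = y / (1 - y)\<close> into the quadratic and multiply by the
    square of \<open>1 - y\<close>.\<close>
  moreover have "of_int (a - b + c) * y\<^sup>2 + of_int (b - 2 * c) * y + of_int c = 0"
  proof -
    have "of_int (a - b + c) * y\<^sup>2 + of_int (b - 2 * c) * y + of_int c =
        of_int a * y\<^sup>2 + of_int b * y * (1 - y) + of_int c * (1 - y)\<^sup>2"
      by (simp add: algebra_simps power2_eq_square)
    also have "\<dots> = of_int a * (x * (1 - y))\<^sup>2 + of_int b * (x * (1 - y)) * (1 - y) + of_int c * (1 - y)\<^sup>2"
      using x(3) by (simp add: y_def)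
    also have "\<dots> = (of_int a * x\<^sup>2 + of_int b * x + of_int c) * (1 - y)\<^sup>2"
      by (simp add: algebra_simps power2_eq_square)
    finally show ?thesis using h(2) by simp
  qed
  \<comment> \<open>The new leading coefficient is the old polynomial at \<open>-1\<close>. If it
    vanished, \<open>x\<close> would be the other root \<open>- c / a\<close>, which is
    rational.\<close>
  moreover have "a - b + c \<noteq> 0"
  proof
    assume "a - b + c = 0"
    then have "of_int b = of_int a + (of_int c :: real)"
      by (simp flip: of_int_add)
    then have "(x + 1) * (of_int a * x + of_int c) = 0"
      using h(2) by (simp add: algebra_simps power2_eq_square)
    then have "of_int a * x + of_int c = 0" using assms(2) by simp
    then have "x = - of_int c / of_int a" using h(1) by (simp add: field_simps eq_neg_iff_add_eq_0)
    then have "x \<in> \<rat>" by simp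
    with h(3) show False ..
  qed
  ultimately show ?thesis unfolding quadratic_irrational_def y_def by blast
qed

lemma quadratic_irrational_word_moebius:
  assumes "quadratic_irrational x" "0 < x"
  shows "quadratic_irrational (word_moebius w x)"
  by (induction w)
    (auto simp: assms word_moebius_pos quadratic_irrational_add_1 quadratic_irrational_div_1_plus)

section \<open>Rational arguments with odd and with even denominator\<close>

lemma odd_denominator:
  fixes p q :: int
  assumes "0 < p" "p < q" "odd q"
  shows "\<exists>(n::nat) (m::int). 1 \<le> m \<and> m \<le> 2 ^ n - 2 \<and>
    of_int p / of_int q = (of_int m / (2 ^ n - 1) :: real)"
proof -
  \<comment> \<open>Euler's theorem makes \<open>q\<close> a divisor of \<open>2 ^ n - 1\<close>
    with \<open>n\<close> the totient of \<open>q\<close>; the fraction is then expanded by the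
    cofactor \<open>k\<close>.\<close>
  have "coprime 2 (nat q)" using assms by (simp add: even_nat_iff)
  then have "[2 ^ totient (nat q) = 1] (mod nat q)" by (rule euler_theorem)
  then have "[int (2 ^ totient (nat q)) = int 1] (mod int (nat q))" by (simp only: cong_int_iff)
  then have "q dvd 2 ^ totient (nat q) - 1" using assms by (simp add: cong_iff_dvd_diff)
  then obtain k where k: "2 ^ totient (nat q) - 1 = q * k" by (rule dvdE)
  define n where "n = totient (nat q)"
  have "n > 0" using assms by (simp add: n_def)
  then have "(2::int) ^ 1 \<le> 2 ^ n" by (intro power_increasing) auto
  then have "0 < q * k" using k by (simp add: n_def)
  then have "0 < k" using assms by (simp add: zero_less_mult_iff)
  have kn: "(2::int) ^ n = q * k + 1" using k by (simp add: n_def)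
  have "1 \<le> p * k" using \<open>0 < k\<close> assms(1) by (simp add: int_one_le_iff_zero_less)
  moreover have "(p + 1) * k \<le> q * k" using assms \<open>0 < k\<close> by (intro mult_right_mono) auto
  then have "p * k \<le> 2 ^ n - 2" using kn \<open>0 < k\<close> by (simp add: algebra_simps)
  moreover have "(2::real) ^ n = of_int q * of_int k + 1"
    using arg_cong[OF kn, of real_of_int] by simp
  then have "of_int p / of_int q = (of_int (p * k) / (2 ^ n - 1) :: real)"
    using \<open>0 < k\<close> assms by simp
  ultimately show ?thesis by blast
qed

text \<open>Conversely, coprimality turns the equation into \<open>q\<close> dividing
  \<open>2 ^ n - 1\<close>, which is odd because the bounds on \<open>m\<close> exclude
  \<open>n = 0\<close>.\<close>

lemma odd_denominator_iff:
  fixes p q :: int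
  assumes "0 < p" "p < q" "coprime p q"
  shows "(\<exists>(n::nat) (m::int). 1 \<le> m \<and> m \<le> 2 ^ n - 2 \<and>
    of_int p / of_int q = (of_int m / (2 ^ n - 1) :: real)) \<longleftrightarrow> odd q"
proof safe
  fix n :: nat and m :: int
  assume m: "1 \<le> m" "m \<le> 2 ^ n - 2" and eq: "of_int p / of_int q = (of_int m / (2 ^ n - 1) :: real)"
    and "even q"
  have n: "(3::int) \<le> 2 ^ n" using m by linarith
  then have "real_of_int 3 \<le> real_of_int (2 ^ n)" by (simp only: of_int_le_iff)
  then have "real_of_int p * (2 ^ n - 1) = of_int m * of_int q"
    using eq assms by (simp add: divide_simps mult.commute)
  then have "real_of_int (p * (2 ^ n - 1)) = real_of_int (m * q)" by simp
  then have "p * (2 ^ n - 1) = m * q" unfolding of_int_eq_iff .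
  then have "q dvd p * (2 ^ n - 1)" by simp
  then have "q dvd 2 ^ n - 1" using assms(3) by (simp add: coprime_dvd_mult_right_iff coprime_commute)
  then have "even ((2::int) ^ n - 1)" using \<open>even q\<close> by (rule dvd_trans[rotated])
  moreover have "n \<noteq> 0" using n by (intro notI) simp
  ultimately show False by simp
qed (use odd_denominator assms in blast)

text \<open>Write \<open>q = 2 ^ s * r\<close> with \<open>r\<close> odd. The quotient of
  \<open>p\<close> by \<open>r\<close> supplies a preperiod of \<open>s\<close> digits, and the
  remainder gives a purely periodic \<open>u\<close>. The value at \<open>u\<close> is fixed by a
  Moebius map, and the preperiod preserves quadratic irrationality.\<close>

lemma rational_nondyadic_quadratic_irrational:
  fixes p q :: int and t :: real
  assumes t: "t \<in> {0..<1}" and pq: "0 < p" "0 < q" "t = of_int p / of_int q"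
    and nd: "\<not> (\<exists>(n::nat) (m::int). t = of_int m / 2 ^ n)"
  shows "quadratic_irrational (assembly t)"
proof -
  obtain r where r: "q = 2 ^ multiplicity 2 q * r" "odd r"
    using multiplicity_decompose'[of q 2] pq by auto
  define s where "s = multiplicity 2 q"
  have q: "q = 2 ^ s * r" using r by (simp add: s_def)
  have "0 < r" using q pq by (simp add: zero_less_mult_iff)
  define u where "u = (of_int (p mod r) / of_int r :: real)"
  have eq: "t = (u + of_int (p div r)) / 2 ^ s"
  proof -
    have "of_int p = of_int (p div r) * of_int r + (of_int (p mod r) :: real)"
      by (metis div_mult_mod_eq of_int_add of_int_mult)
    then show ?thesis using \<open>0 < r\<close> unfolding u_def pq(3) q by (simp add: field_simps)
  qed
  have "p mod r < r" "0 \<le> p mod r" using \<open>0 < r\<close> by auto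
  then have u: "u \<in> {0..<1}" using \<open>0 < r\<close> by (simp add: u_def)
  have N: "0 \<le> p div r" using pq \<open>0 < r\<close> by (simp add: pos_imp_zdiv_nonneg_iff)
  \<comment> \<open>The quotient fits into \<open>s\<close> binary digits because
    \<open>t < 1\<close>.\<close>
  have "p < q" using t pq by simp
  then have "p < 2 ^ s * r" by (simp add: q)
  then have "p div r < 2 ^ s" 
    using \<open>0 < r\<close> minus_mod_eq_div_mult[of p r] \<open>0 \<le> p mod r\<close> mult_less_cancel_right_pos[of r "p div r" "2 ^ s"]
    by linarith
  then have "int (nat (p div r)) < int (2 ^ s)" using N by simp
  then have "nat (p div r) < 2 ^ s" unfolding of_nat_less_iff .
  then obtain w where w: "length w = s" "word_val w = nat (p div r)" using word_val_surj by blast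
  have tw: "t = word_map w u" unfolding word_map_eq eq using w N by simp
  have nd_u: "u \<noteq> of_int m / 2 ^ n" for m :: int and n :: nat
  proof
    assume "u = of_int m / 2 ^ n"
    then have "t = of_int (m + (p div r) * 2 ^ n) / 2 ^ (n + s)"
      unfolding eq by (simp add: field_simps power_add)
    with nd show False by blast
  qed
  have "p mod r \<noteq> 0" using nd_u[of 0 0] by (auto simp: u_def)
  with \<open>0 \<le> p mod r\<close> have "0 < p mod r" by simp
  then have "0 < u" using \<open>0 < r\<close> by (simp add: u_def)
  obtain n :: nat and m :: int where nm: "1 \<le> m" "m \<le> 2 ^ n - 2" "u = of_int m / (2 ^ n - 1)"
    using odd_denominator[OF \<open>0 < p mod r\<close> \<open>p mod r < r\<close> r(2)] unfolding u_def by blast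
  have "int (nat m) < int (2 ^ n)" using nm by simp
  then have "nat m < 2 ^ n" unfolding of_nat_less_iff .
  then obtain v where v: "length v = n" "word_val v = nat m" using word_val_surj by blast
  have "v \<noteq> []" using v nm by auto
  then have "word_map v u = u" using word_map_fixed_iff[of v u] v nm by simp
  then have fixed: "word_moebius v (assembly u) = assembly u" using assembly_word_map[OF u, of v] by simp
  have "assembly u \<notin> \<rat>"
  proof
    assume "assembly u \<in> \<rat>"
    with u obtain k l :: nat where "u = real l / 2 ^ k" by (rule assembly_rational_imp_dyadic)
    then show False using nd_u[of "int l" k] by simp
  qed
  then have "quadratic_irrational (assembly u)"
    using \<open>v \<noteq> []\<close> assembly_nonneg[OF u] fixed by (intro quadratic_irrational_fixed_point)
  then show ?thesis
    unfolding tw assembly_word_map[OF u]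
    using assembly_pos[OF u \<open>0 < u\<close>] by (rule quadratic_irrational_word_moebius)
qed

section \<open>Continued fractions\<close>

text \<open>The continued fraction whose partial quotients are the list and whose last complete
  quotient is the real number \<open>y\<close>.\<close>

fun cf_tail :: "int list \<Rightarrow> real \<Rightarrow> real" where
  "cf_tail [] y = y"
| "cf_tail (a # as) y = of_int a + 1 / cf_tail as y"

lemma cf_tail_pos: "(\<forall>a\<in>set as. 1 \<le> a) \<Longrightarrow> 0 < y \<Longrightarrow> 0 < cf_tail as y"
  by (induction as) (auto intro!: add_pos_pos)

lemma cf_tail_ge_1:
  assumes "as \<noteq> []" "\<forall>a\<in>set as. 1 \<le> a" "0 < y"
  shows "1 \<le> cf_tail as y"
proof (cases as)
  case (Cons a bs)
  then have "0 < cf_tail bs y" "1 \<le> real_of_int a" using assms cf_tail_pos[of bs y] by auto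
  then have "0 \<le> 1 / cf_tail bs y" by simp
  with \<open>1 \<le> real_of_int a\<close> have "1 \<le> of_int a + 1 / cf_tail bs y" by linarith
  then show ?thesis by (simp only: Cons cf_tail.simps)
qed (use assms in simp)

lemma cf_tail_tendsto:
  assumes "\<forall>a\<in>set as. 1 \<le> a" "f \<longlonglongrightarrow> y" "0 < y"
  shows "(\<lambda>n. cf_tail as (f n)) \<longlonglongrightarrow> cf_tail as y"
  using assms(1)
proof (induction as)
  case Nil
  show ?case using assms(2) by simp
next
  case (Cons a as)
  have "0 < cf_tail as y" using Cons.prems assms(3) by (intro cf_tail_pos) auto
  with Cons show ?case by (auto intro!: tendsto_intros)
qed

text \<open>The list consists of the run lengths of \<open>w\<close>. Since the last run consists of
  0s, the parity of the number of runs determines the first digit; a word starting with 0 yields the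
  reciprocal.\<close>

lemma word_moebius_cf_tail:
  assumes "w \<noteq> []" "\<not> last w"
  shows "\<exists>as. as \<noteq> [] \<and> (\<forall>a\<in>set as. 1 \<le> a) \<and> (even (length as) \<longleftrightarrow> hd w) \<and>
    (\<forall>x>0. word_moebius w x = (if hd w then cf_tail as x else 1 / cf_tail as x))"
  using assms
proof (induction w rule: list_nonempty_induct)
  case (single b)
  then have "word_moebius [b] x = 1 / cf_tail [1] x" if "0 < x" for x
    using that by (simp add: field_simps)
  with single show ?case by (intro exI[of _ "[1]"]) simp
next
  case (cons b w)
  then obtain a as where as: "\<forall>a\<in>set (a # as). 1 \<le> a" "even (length (a # as)) \<longleftrightarrow> hd w"
    "\<And>x. 0 < x \<Longrightarrow> word_moebius w x = (if hd w then cf_tail (a # as) x else 1 / cf_tail (a # as) x)"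
    by (metis last_ConsR list.exhaust)
  have pos: "0 < cf_tail (a # as) x" if "0 < x" for x using cf_tail_pos as(1) that by blast
  have incr: "cf_tail ((a + 1) # as) x = 1 + cf_tail (a # as) x" for x by simp
  have one: "cf_tail (1 # a # as) x = 1 + 1 / cf_tail (a # as) x" for x
    by (simp only: cf_tail.simps(2)[of 1] of_int_1)
  \<comment> \<open>These are the two effects of prepending 0: it opens a new run before a word
    starting with 1, and lengthens the first run of a word starting with 0.\<close>
  have calc: "y / (1 + y) = 1 / (1 + 1 / y)" "(1 / y) / (1 + 1 / y) = 1 / (1 + y)" if "0 < y" for y :: real
    using that by (simp_all add: divide_simps add.commute)
  show ?case
  proof (cases "b = hd w")
    case True
    have "word_moebius (b # w) x =
        (if b then cf_tail ((a + 1) # as) x else 1 / cf_tail ((a + 1) # as) x)" if "0 < x" for x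
      unfolding incr using as(3)[OF that] calc(2)[OF pos[OF that]] True
      by (simp only: word_moebius.simps split: if_split) blast
    with as True show ?thesis by (intro exI[of _ "(a + 1) # as"]) (simp del: cf_tail.simps)
  next
    case False
    have "word_moebius (b # w) x =
        (if b then cf_tail (1 # a # as) x else 1 / cf_tail (1 # a # as) x)" if "0 < x" for x
      unfolding one using as(3)[OF that] calc(1)[OF pos[OF that]] False
      by (simp only: word_moebius.simps split: if_split) blast
    with as False show ?thesis by (intro exI[of _ "1 # a # as"]) (simp del: cf_tail.simps)
  qed
qed

lemma word_moebius_replicate_True:
  "word_moebius (replicate k True @ w) x = real k + word_moebius w x"
  by (induction k) auto

text \<open>Each 0 increases the reciprocal of the value by 1.\<close>

lemma word_moebius_replicate_False:
  assumes "0 < x"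
  shows "word_moebius (replicate k False @ w) x = 1 / (real k + 1 / word_moebius w x)"
proof (induction k)
  case (Suc k)
  have "0 < 1 / word_moebius w x" using word_moebius_pos[OF assms] by simp
  then have "0 < real k + 1 / word_moebius w x" by (intro add_nonneg_pos) auto
  moreover have "(1 / y) / (1 + 1 / y) = 1 / (1 + y)" if "0 < y" for y :: real
    using that by (simp add: divide_simps add.commute)
  ultimately have "word_moebius (replicate (Suc k) False @ w) x = 1 / (1 + (real k + 1 / word_moebius w x))"
    using Suc by simp
  then show ?case by (simp add: add.assoc)
qed simp

lemma cf_tail_word_moebius:
  assumes "as \<noteq> []" "\<forall>a\<in>set as. 1 \<le> a"
  shows "\<exists>w. w \<noteq> [] \<and> \<not> last w \<and> (hd w \<longleftrightarrow> even (length as)) \<and>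
    (\<forall>x>0. word_moebius w x = (if even (length as) then cf_tail as x else 1 / cf_tail as x))"
  using assms
proof (induction as rule: list_nonempty_induct)
  case (single a)
  then have a: "nat a \<noteq> 0" "real (nat a) = of_int a" by auto
  have "word_moebius (replicate (nat a) False) x = 1 / cf_tail [a] x" if "0 < x" for x
    using word_moebius_replicate_False[OF that, of "nat a" "[]"] a by simp
  with a show ?case by (intro exI[of _ "replicate (nat a) False"]) simp
next
  case (cons a as)
  then obtain w where w: "w \<noteq> []" "\<not> last w"
    "\<And>x. 0 < x \<Longrightarrow> word_moebius w x = (if even (length as) then cf_tail as x else 1 / cf_tail as x)"
    by auto
  have a: "nat a \<noteq> 0" "real (nat a) = of_int a" using cons.prems by auto
  \<comment> \<open>Runs alternate and the last one consists of 0s, so the digit of a run is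
    determined by the parity of the number of runs after it.\<close>
  define b where "b = odd (length as)"
  have "word_moebius (replicate (nat a) b @ w) x =
      (if even (length (a # as)) then cf_tail (a # as) x else 1 / cf_tail (a # as) x)" if "0 < x" for x
    using w(3)[OF that] a word_moebius_replicate_False[OF that, of "nat a" w]
    by (cases b) (simp_all add: b_def word_moebius_replicate_True)
  moreover have "hd (replicate (nat a) b @ w) = b" using a by simp
  ultimately show ?case using w a
    by (intro exI[of _ "replicate (nat a) b @ w"]) (simp add: b_def)
qed

section \<open>Convergents and purely periodic expansions\<close>

lemma cf_convergent_ge_1: "(\<And>i. 1 \<le> a i) \<Longrightarrow> 1 \<le> cf_convergent a n"
proof (induction n arbitrary: a)
  case (Suc n)
  have "1 \<le> cf_convergent (\<lambda>i. a (Suc i)) n" by (rule Suc.IH) (rule Suc.prems)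
  then have "0 \<le> 1 / cf_convergent (\<lambda>i. a (Suc i)) n" by simp
  moreover have "1 \<le> real_of_int (a 0)" using Suc.prems[of 0] by simp
  ultimately show ?case unfolding cf_convergent.simps by linarith
qed simp

lemma cf_convergent_add:
  "cf_convergent a (n + k) = cf_tail (map a [0..<k]) (cf_convergent (\<lambda>i. a (i + k)) n)"
proof (induction k arbitrary: a)
  case (Suc k)
  show ?case
    using Suc[of "\<lambda>i. a (Suc i)"] by (simp add: map_upt_Suc del: upt_Suc)
qed simp

lemma cf_step_diff:
  fixes x y :: real
  assumes "0 < x" "0 < y"
  shows "\<bar>(c + 1 / x) - (c + 1 / y)\<bar> = \<bar>x - y\<bar> / (x * y)"
proof -
  have "(c + 1 / x) - (c + 1 / y) = - ((x - y) / (x * y))"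
    using assms by (simp add: field_simps)
  then have "\<bar>(c + 1 / x) - (c + 1 / y)\<bar> = \<bar>(x - y) / (x * y)\<bar>" by (simp only: abs_minus_cancel)
  then show ?thesis using assms by (simp add: abs_divide abs_mult)
qed

text \<open>One step of the continued fraction need not contract uniformly, but since
  \<open>x\<^sub>1 x\<^sub>2 = a\<^sub>1 x\<^sub>2 + 1 \<ge> 2\<close>, two steps contract by a factor of at least 4.\<close>
lemma cf_convergent_error:
  fixes x :: "nat \<Rightarrow> real"
  assumes "\<And>i. 1 \<le> a i" "\<And>i. x i = of_int (a i) + 1 / x (Suc i)" "\<And>i. 1 \<le> x i"
  shows "\<bar>cf_convergent a n - x 0\<bar> \<le> 2 * (1 / 2) ^ n"
  using assms
\<comment> \<open>Contraction takes two steps, hence two base cases. The error is at most 1 in both,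
  and the factor 2 makes the bound equal to 1 at \<open>n = 1\<close>.\<close>
proof (induction n arbitrary: a x rule: induct_nat_012)
  case 0
  have "x 0 - cf_convergent a 0 = 1 / x 1" using 0(2)[of 0] by simp
  moreover have "0 \<le> 1 / x 1" "1 / x 1 \<le> 1" using 0(3)[of 1] by simp_all
  ultimately have "\<bar>cf_convergent a 0 - x 0\<bar> \<le> 1" by linarith
  then show ?case by simp
next
  case 1
  have x1: "1 \<le> x 1" and a1: "1 \<le> real_of_int (a 1)" using 1(3)[of 1] 1(1)[of 1] by simp_all
  have "\<bar>cf_convergent a 1 - x 0\<bar> = \<bar>of_int (a 1) - x 1\<bar> / (of_int (a 1) * x 1)"
    using cf_step_diff[of "of_int (a 1)" "x 1" "of_int (a 0)"] x1 a1 1(2)[of 0] by simp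
  also have "\<bar>of_int (a 1) - x 1\<bar> = 1 / x 2"
    using 1(2)[of 1] 1(3)[of 2] by (simp add: numeral_2_eq_2)
  also have "1 / x 2 / (of_int (a 1) * x 1) \<le> 1 / 1"
  proof (rule frac_le)
    show "1 / x 2 \<le> 1" using 1(3)[of 2] by simp
    have "1 * 1 \<le> of_int (a 1) * x 1" using x1 a1 by (intro mult_mono) linarith+
    then show "1 \<le> of_int (a 1) * x 1" by simp
  qed simp_all
  finally show ?case by simp
next
  case (ge2 n)
  define c where "c = cf_convergent (\<lambda>i. a (Suc (Suc i))) n"
  define d where "d = of_int (a 1) + 1 / c"
  have IH: "\<bar>c - x 2\<bar> \<le> 2 * (1 / 2) ^ n"
    unfolding c_def numeral_2_eq_2
    by (rule ge2.IH(1)[of "\<lambda>i. a (Suc (Suc i))" "\<lambda>i. x (Suc (Suc i))", unfolded numeral_2_eq_2])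
      (rule ge2.prems)+
  have c: "1 \<le> c" unfolding c_def by (rule cf_convergent_ge_1) (rule ge2.prems)
  have a1: "1 \<le> real_of_int (a 1)" using ge2.prems(1)[of 1] by simp
  have x2: "1 \<le> x 2" by (rule ge2.prems)
  have x1: "x 1 = of_int (a 1) + 1 / x 2" using ge2.prems(2)[of 1] by (simp add: numeral_2_eq_2)
  have d0: "0 < d" using c a1 by (simp add: d_def add_pos_nonneg)
  have x10: "0 < x 1" using ge2.prems(3)[of 1] by simp
  have two: "2 \<le> (of_int (a 1) + 1 / y) * y" if "1 \<le> y" for y :: real
  proof -
    have "1 * 1 \<le> of_int (a 1) * y" using that a1 by (intro mult_mono) linarith+
    then show ?thesis using that by (simp add: distrib_right)
  qed
  have "2 * 2 \<le> (d * c) * (x 1 * x 2)"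
    unfolding d_def x1 using two[OF c] two[OF x2] by (intro mult_mono) auto
  then have four: "4 \<le> c * x 2 * (d * x 1)" by (simp add: mult_ac)
  have "cf_convergent a (Suc (Suc n)) = of_int (a 0) + 1 / d" by (simp add: c_def d_def)
  moreover have "x 0 = of_int (a 0) + 1 / x 1" using ge2.prems(2)[of 0] by simp
  ultimately have "\<bar>cf_convergent a (Suc (Suc n)) - x 0\<bar> = \<bar>d - x 1\<bar> / (d * x 1)"
    using cf_step_diff[OF d0 x10] by simp
  also have "\<bar>d - x 1\<bar> = \<bar>c - x 2\<bar> / (c * x 2)"
    unfolding d_def x1 by (rule cf_step_diff) (use c x2 in auto)
  also have "\<bar>c - x 2\<bar> / (c * x 2) / (d * x 1) = \<bar>c - x 2\<bar> / (c * x 2 * (d * x 1))"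
    by simp
  also have "\<dots> \<le> (2 * (1 / 2) ^ n) / 4" using IH four by (intro frac_le) auto
  also have "\<dots> = 2 * (1 / 2) ^ Suc (Suc n)" by simp
  finally show ?case .
qed

text \<open>Passing to the limit over whole periods turns a periodic expansion into a fixed point of
  \<open>cf_tail\<close>. Conversely, repeating the list gives partial quotients whose convergents
  approach the fixed point by \<open>cf_convergent_error\<close>.\<close>

lemma scf_purely_periodic_iff:
  "scf_purely_periodic x \<longleftrightarrow>
    0 < x \<and> (\<exists>as. as \<noteq> [] \<and> even (length as) \<and> (\<forall>a\<in>set as. 1 \<le> a) \<and> cf_tail as x = x)"
proof safe
  assume "scf_purely_periodic x"
  then obtain a k where a: "\<And>i. 1 \<le> i \<Longrightarrow> 1 \<le> a i" "cf_convergent a \<longlonglongrightarrow> x" "1 \<le> k"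
    "\<And>i. a (i + k) = a i"
    by (auto simp: scf_purely_periodic_def infinite_scf_expansion_def)
  \<comment> \<open>Periodicity extends positivity to the quotient at index 0, which an expansion
    leaves unrestricted.\<close>
  have a1: "1 \<le> a i" for i using a(1)[of "i + k"] a(3,4) by simp
  have "1 \<le> cf_convergent a n" for n using a1 by (rule cf_convergent_ge_1)
  then have "1 \<le> x" by (intro LIMSEQ_le_const[OF a(2)] exI[of _ 0] allI impI)
  then show "0 < x" by simp
  \<comment> \<open>Doubling the period makes its length even.\<close>
  define as where "as = map a [0..<k + k]"
  have as: "\<forall>a\<in>set as. 1 \<le> a" using a1 by (auto simp: as_def)
  have "a (i + (k + k)) = a i" for i using a(4)[of "i + k"] a(4)[of i] by (simp add: add.assoc)
  then have "cf_convergent a (n + (k + k)) = cf_tail as (cf_convergent a n)" for n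
    unfolding cf_convergent_add as_def by simp
  then have "(\<lambda>n. cf_tail as (cf_convergent a n)) \<longlonglongrightarrow> x"
    using LIMSEQ_ignore_initial_segment[OF a(2), of "k + k"] by simp
  moreover have "(\<lambda>n. cf_tail as (cf_convergent a n)) \<longlonglongrightarrow> cf_tail as x"
    using as a(2) \<open>0 < x\<close> by (rule cf_tail_tendsto)
  ultimately have "cf_tail as x = x" using LIMSEQ_unique by blast
  moreover have "as \<noteq> []" "even (length as)" using a(3) by (simp_all add: as_def)
  ultimately show "\<exists>as. as \<noteq> [] \<and> even (length as) \<and> (\<forall>a\<in>set as. 1 \<le> a) \<and> cf_tail as x = x"
    using as by blast
next
  fix as :: "int list"
  assume x: "0 < x" and as: "as \<noteq> []" "\<forall>a\<in>set as. 1 \<le> a" "cf_tail as x = x"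
  define K where "K = length as"
  have K: "0 < K" using as by (simp add: K_def)
  define a where "a i = as ! (i mod K)" for i
  \<comment> \<open>These are the complete quotients. At the end of a period the remaining list is
    empty and \<open>cf_tail as x = x\<close> closes the cycle.\<close>
  define y where "y i = cf_tail (drop (i mod K) as) x" for i
  have iK: "i mod K < length as" for i using K by (simp add: K_def)
  have a1: "1 \<le> a i" for i using as(2) iK[of i] by (simp add: a_def)
  have y1: "1 \<le> y i" for i
    unfolding y_def using as(2) iK[of i] x by (intro cf_tail_ge_1) (auto dest: in_set_dropD)
  have step: "y i = of_int (a i) + 1 / y (Suc i)" for i
  proof -
    have "y i = of_int (a i) + 1 / cf_tail (drop (Suc (i mod K)) as) x"
      unfolding y_def a_def Cons_nth_drop_Suc[OF iK, symmetric] by simp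
    moreover have "cf_tail (drop (Suc (i mod K)) as) x = y (Suc i)"
    proof (cases "Suc (i mod K) = K")
      case True
      then have "Suc i mod K = 0" by (simp add: mod_Suc)
      then show ?thesis using True as(3) by (simp add: y_def K_def)
    next
      case False
      then show ?thesis by (simp add: y_def mod_Suc)
    qed
    ultimately show ?thesis by simp
  qed
  have "y 0 = x" using as(3) by (simp add: y_def)
  then have err: "\<bar>cf_convergent a n - x\<bar> \<le> 2 * (1 / 2) ^ n" for n
    using cf_convergent_error[of a y n, OF a1 step y1] by simp
  have "(\<lambda>n. 2 * (1 / 2 :: real) ^ n) \<longlonglongrightarrow> 2 * 0"
    by (intro tendsto_intros LIMSEQ_power_zero) simp
  moreover have "\<forall>\<^sub>F n in sequentially. norm (cf_convergent a n - x) \<le> 2 * (1 / 2) ^ n"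
    using err by (intro always_eventually allI) (simp only: real_norm_def)
  ultimately have "(\<lambda>n. cf_convergent a n - x) \<longlonglongrightarrow> 0"
    by (simp only: mult_zero_right Lim_null_comparison)
  then have "cf_convergent a \<longlonglongrightarrow> x" by (rule LIM_zero_cancel)
  then have "infinite_scf_expansion a x" using a1 by (simp add: infinite_scf_expansion_def)
  moreover have "a (i + K) = a i" for i by (simp add: a_def)
  ultimately show "scf_purely_periodic x"
    unfolding scf_purely_periodic_def using K
    by (intro exI[of _ a] conjI exI[of _ K]) simp_all
qed

lemma scf_purely_periodic_iff_word:
  "scf_purely_periodic x \<longleftrightarrow>
    0 < x \<and> (\<exists>w. w \<noteq> [] \<and> hd w \<and> \<not> last w \<and> word_moebius w x = x)"
proof -
  have "(\<exists>as. as \<noteq> [] \<and> even (length as) \<and> (\<forall>a\<in>set as. 1 \<le> a) \<and> cf_tail as x = x) \<longleftrightarrow>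
      (\<exists>w. w \<noteq> [] \<and> hd w \<and> \<not> last w \<and> word_moebius w x = x)" if "0 < x"
  proof safe
    fix as :: "int list"
    assume "as \<noteq> []" "even (length as)" "\<forall>a\<in>set as. 1 \<le> a" "cf_tail as x = x"
    then show "\<exists>w. w \<noteq> [] \<and> hd w \<and> \<not> last w \<and> word_moebius w x = x"
      using cf_tail_word_moebius[of as] that by auto
  next
    fix w
    assume "w \<noteq> []" "hd w" "\<not> last w" "word_moebius w x = x"
    then show "\<exists>as. as \<noteq> [] \<and> even (length as) \<and> (\<forall>a\<in>set as. 1 \<le> a) \<and> cf_tail as x = x"
      using word_moebius_cf_tail[of w] that by auto
  qed
  then show ?thesis unfolding scf_purely_periodic_iff by blast
qed

text \<open>The parity of the value of a word shows its last digit, and comparison with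
  \<open>2 ^ (n - 1)\<close> its first. Injectivity transfers fixed points of the Moebius map back
  to fixed points of \<open>word_map\<close>.\<close>

lemma scf_purely_periodic_assembly_iff:
  assumes t: "t \<in> {0..<1}"
  shows "scf_purely_periodic (assembly t) \<longleftrightarrow>
    (\<exists>(n::nat) (m::int). even m \<and> 2 ^ (n - 1) \<le> m \<and> m \<le> 2 ^ n - 2 \<and> t = of_int m / (2 ^ n - 1))"
proof
  assume "scf_purely_periodic (assembly t)"
  then obtain w where w: "w \<noteq> []" "hd w" "\<not> last w" "word_moebius w (assembly t) = assembly t"
    unfolding scf_purely_periodic_iff_word by blast
  then have "assembly (word_map w t) = assembly t" using assembly_word_map[OF t] by simp
  then have "word_map w t = t" using inj_onD[OF assembly_inj] word_map_unit[OF t] t by blast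
  then have teq: "t = of_int (int (word_val w)) / (2 ^ length w - 1)"
    using word_map_fixed_iff[OF w(1)] by simp
  have ev: "even (int (word_val w))" using even_word_val_iff[OF w(1)] w(3) by simp
  have "int (2 ^ (length w - 1)) \<le> int (word_val w)"
    using hd_word_iff[OF w(1)] w(2) unfolding of_nat_le_iff by simp
  then have ge: "2 ^ (length w - 1) \<le> int (word_val w)" by simp
  have "int (word_val w) < int (2 ^ length w)" using word_val_less[of w] unfolding of_nat_less_iff .
  then have "int (word_val w) < 2 ^ length w" by simp
  moreover have "even ((2::int) ^ length w)" using w(1) by simp
  \<comment> \<open>Two even integers that differ do so by at least 2, which sharpens the bound
    \<open>2 ^ n - 1\<close> to \<open>2 ^ n - 2\<close>.\<close>
  moreover have "i \<le> j - 2" if "i < j" "even j" "even i" for i j :: int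
    using that by presburger
  ultimately have "int (word_val w) \<le> 2 ^ length w - 2" using ev by blast
  with ev ge teq show "\<exists>(n::nat) (m::int). even m \<and> 2 ^ (n - 1) \<le> m \<and> m \<le> 2 ^ n - 2 \<and>
      t = of_int m / (2 ^ n - 1)" by blast
next
  assume "\<exists>(n::nat) (m::int). even m \<and> 2 ^ (n - 1) \<le> m \<and> m \<le> 2 ^ n - 2 \<and> t = of_int m / (2 ^ n - 1)"
  then obtain n :: nat and m :: int where m: "even m" "2 ^ (n - 1) \<le> m" "m \<le> 2 ^ n - 2"
    "t = of_int m / (2 ^ n - 1)" by blast
  \<comment> \<open>Truncated subtraction gives \<open>2 ^ (n - 1) = 1\<close> also at
    \<open>n = 0\<close>, so \<open>m\<close> is positive in every case and the word below is
    nonempty.\<close>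
  have "(1::int) \<le> 2 ^ (n - 1)" by simp
  then have m1: "1 \<le> m" using m(2) by linarith
  have "int (nat m) < int (2 ^ n)" using m m1 by simp
  then have "nat m < 2 ^ n" unfolding of_nat_less_iff .
  then obtain w where w: "length w = n" "word_val w = nat m" using word_val_surj by blast
  have "w \<noteq> []" using w m1 by auto
  then have "word_map w t = t" using word_map_fixed_iff[of w t] w m m1 by simp
  then have fixed: "word_moebius w (assembly t) = assembly t" using assembly_word_map[OF t, of w] by simp
  have "int (2 ^ (n - 1)) \<le> int (nat m)" using m m1 by simp
  then have "2 ^ (n - 1) \<le> nat m" unfolding of_nat_le_iff .
  then have "hd w" using hd_word_iff[OF \<open>w \<noteq> []\<close>] w by simp
  moreover have "\<not> last w" using even_word_val_iff[OF \<open>w \<noteq> []\<close>] w m(1) m1 by (simp add: even_nat_iff)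
  moreover have "3 \<le> (2::int) ^ n" using m m1 by linarith
  then have "real_of_int 3 \<le> real_of_int (2 ^ n)" by (simp only: of_int_le_iff)
  then have "0 < t" using m(4) m1 by simp
  then have "0 < assembly t" using t by (intro assembly_pos)
  ultimately show "scf_purely_periodic (assembly t)"
    unfolding scf_purely_periodic_iff_word using \<open>w \<noteq> []\<close> fixed by blast
qed

theorem theorem7p6:
  fixes \<theta> \<omega> :: real
  assumes "\<theta> \<in> {0..<1}" and "\<omega> = assembly \<theta>"
  shows "(pure_quadratic_irrational \<omega> \<longleftrightarrow>
            (\<exists>(n::nat) (m::int). 1 \<le> m \<and> m \<le> 2 ^ n - 2 \<and> \<theta> = of_int m / (2 ^ n - 1)))
       \<and> (\<forall>p q :: int. p > 0 \<and> q > 0 \<and> coprime p q \<and> \<theta> = of_int p / of_int q \<and>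
            \<not> (\<exists>(n::nat) (m::int). \<theta> = of_int m / 2 ^ n) \<longrightarrow>
            (pure_quadratic_irrational \<omega> \<longleftrightarrow> odd q) \<and>
            (nonpure_quadratic_irrational \<omega> \<longleftrightarrow> even q))
       \<and> (scf_purely_periodic \<omega> \<longleftrightarrow>
            (\<exists>(n::nat) (m::int). even m \<and> 2 ^ (n - 1) \<le> m \<and> m \<le> 2 ^ n - 2 \<and>
               \<theta> = of_int m / (2 ^ n - 1)))"
proof -
  have "(pure_quadratic_irrational \<omega> \<longleftrightarrow> odd q) \<and> (nonpure_quadratic_irrational \<omega> \<longleftrightarrow> even q)"
    if pq: "p > 0" "q > 0" "coprime p q" "\<theta> = of_int p / of_int q"
      and nd: "\<not> (\<exists>(n::nat) (m::int). \<theta> = of_int m / 2 ^ n)" for p q :: int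
  proof -
    have "p < q" using assms(1) pq by simp
    then have pure: "pure_quadratic_irrational \<omega> \<longleftrightarrow> odd q"
      using odd_denominator_iff[OF pq(1) _ pq(3)] pq(4)
      unfolding assms(2) pure_quadratic_irrational_iff[OF assms(1)] by simp
    \<comment> \<open>Every such value is a quadratic irrational, so being non-pure is just the
      negation of being pure.\<close>
    moreover have "quadratic_irrational \<omega>"
      unfolding assms(2) using assms(1) pq(1,2,4) nd by (rule rational_nondyadic_quadratic_irrational)
    ultimately show ?thesis unfolding nonpure_quadratic_irrational_def by blast
  qed
  then show ?thesis
    unfolding assms(2) pure_quadratic_irrational_iff[OF assms(1), symmetric]
      scf_purely_periodic_assembly_iff[OF assms(1), symmetric]
    by blast
qed

end
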